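(* For every integer $k\geq 2$, none of the sequences $(\rho(n))_{n\geq 1}$, $(\tau(n^2))_{n\geq 1}$, $(\tau^2(n))_{n\geq 1}$ is $k$-regular, where $\tau(n)$ is the number of positive divisors of $n$ and $\rho(n)=2^{\omega(n)}$ with $\omega(n)$ the number of distinct prime divisors of $n$.
   Context: An integer sequence $(s(n))$ is $k$-regular if its $k$-kernel $\{(s(k^l n+r))_{n}: l\geq 0,\ 0\leq r<k^l\}$ is contained in the $\mathbb{Z}$-linear span of finitely many integer sequences. *)

theory Defs
  imports Main "HOL-Library.FuncSet" "HOL-Computational_Algebra.Primes"
begin

text \<open>
  An integer sequence indexed by \<open>n \<ge> 1\<close> is given by a function on \<open>nat\<close> whose value at \<open>0\<close>
  is irrelevant: sequences are compared after restriction to \<open>{1..}\<close>. For \<open>n \<ge> 1\<close> and \<open>k \<ge> 1\<close>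
  one has \<open>k ^ l * n + r \<ge> 1\<close>, so the kernel never uses the value at \<open>0\<close>.
\<close>

definition kernel :: "nat \<Rightarrow> (nat \<Rightarrow> int) \<Rightarrow> (nat \<Rightarrow> int) set" where
  "kernel k s = {(\<lambda>n\<in>{1..}. s (k ^ l * n + r)) | l r. r < k ^ l}"

definition int_span :: "(nat \<Rightarrow> int) set \<Rightarrow> (nat \<Rightarrow> int) set" where
  "int_span B = {(\<lambda>n\<in>{1..}. \<Sum>b\<in>B. c b * b n) | c. True}"

definition regular_seq :: "nat \<Rightarrow> (nat \<Rightarrow> int) \<Rightarrow> bool" where
  "regular_seq k s \<longleftrightarrow> (\<exists>B. finite B \<and> kernel k s \<subseteq> int_span B)"

definition tau :: "nat \<Rightarrow> nat" where
  "tau n = card {d. d dvd n}"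

definition omega :: "nat \<Rightarrow> nat" where
  "omega n = card {p. prime p \<and> p dvd n}"

definition rho :: "nat \<Rightarrow> nat" where
  "rho n = 2 ^ omega n"

end

theory Submission
  imports Defs "HOL-Number_Theory.Residues"
begin

text \<open>
  Reducing coefficients modulo \<open>M\<close>, a \<open>k\<close>-regular sequence has only finitely many kernel elements
  modulo \<open>M\<close>. Each of the three sequences violates this.

  For \<open>\<rho>\<close> take \<open>M = 4\<close> and residues \<open>r\<^sub>i = q ^ (i + 1)\<close> with a prime \<open>q\<close> not dividing \<open>k\<close>.
  By Euler's theorem some larger power of \<open>q\<close> is \<open>k ^ l * n + r\<^sub>j\<close>, where \<open>\<rho>\<close> is \<open>2\<close>; for
  \<open>i < j\<close> the number \<open>k ^ l * n + r\<^sub>i\<close> is \<open>q ^ (i + 1)\<close> times a cofactor greater than \<open>1\<close> and prime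
  to \<open>q\<close>, so \<open>\<rho>\<close> is divisible by \<open>4\<close> there.

  For \<open>\<tau>(n\<^sup>2)\<close> and \<open>\<tau>\<^sup>2(n)\<close> take \<open>M = 3\<close> and \<open>M = 2\<close>, respectively, and
  \<open>r\<^sub>i = (1 + i q) ^ 6\<close> with a large prime \<open>q\<close>.
  There are \<open>n\<close> for which \<open>k ^ l * n + r\<^sub>j\<close> is the sixth power of a multiple of \<open>q\<close>, so that both
  values are \<open>1\<close> modulo \<open>M\<close>, whereas \<open>q\<close> divides \<open>k ^ l * n + r\<^sub>i\<close> exactly once, so that
  both values vanish modulo \<open>M\<close>.
\<close>

section \<open>Regular sequences modulo an integer\<close>

lemma finite_kernel_mod_of_regular:
  assumes "regular_seq k s" and "M > (0::int)"
  shows "finite ((\<lambda>f. \<lambda>n\<in>{1..}. f n mod M) ` Defs.kernel k s)"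
proof -
  obtain B where B: "finite B" "Defs.kernel k s \<subseteq> int_span B"
    using assms(1) by (auto simp: regular_seq_def)
  let ?G = "(\<lambda>c. \<lambda>n\<in>{1..}. (\<Sum>b\<in>B. c b * b n) mod M) ` (B \<rightarrow>\<^sub>E {0..<M})"
  have "(\<lambda>f. \<lambda>n\<in>{1..}. f n mod M) ` Defs.kernel k s \<subseteq> ?G"
  proof
    fix g assume "g \<in> (\<lambda>f. \<lambda>n\<in>{1..}. f n mod M) ` Defs.kernel k s"
    then obtain f where f: "f \<in> Defs.kernel k s" "g = (\<lambda>n\<in>{1..}. f n mod M)" by blast
    obtain c where c: "f = (\<lambda>n\<in>{1..}. \<Sum>b\<in>B. c b * b n)"
      using f(1) B(2) by (auto simp: int_span_def)
    define c' where "c' = (\<lambda>b\<in>B. c b mod M)"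
    have "(\<Sum>b\<in>B. c b * b n) mod M = (\<Sum>b\<in>B. c' b * b n) mod M" for n
    proof -
      have "(\<Sum>b\<in>B. c b * b n) mod M = (\<Sum>b\<in>B. c b * b n mod M) mod M"
        by (simp add: mod_sum_eq)
      also have "\<dots> = (\<Sum>b\<in>B. c' b * b n mod M) mod M"
        by (rule arg_cong[where f = "\<lambda>x. x mod M"], rule sum.cong)
           (simp_all add: c'_def mod_mult_left_eq)
      finally show ?thesis by (simp add: mod_sum_eq)
    qed
    then have "g = (\<lambda>n\<in>{1..}. (\<Sum>b\<in>B. c' b * b n) mod M)"
      by (auto simp: f(2) c fun_eq_iff restrict_def)
    moreover have "c' \<in> B \<rightarrow>\<^sub>E {0..<M}"
      using assms(2) by (auto simp: c'_def)
    ultimately show "g \<in> ?G" by blast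
  qed
  moreover have "finite ?G"
    using B(1) by (intro finite_imageI finite_PiE) auto
  ultimately show ?thesis by (rule finite_subset)
qed

text \<open>Pigeonhole on the finite set of reduced kernel elements. All \<open>m\<close> residues
  share one level \<open>l\<close>, whereas the separating \<open>n\<close> may depend on the pair
  \<open>i\<close>, \<open>j\<close>.\<close>

lemma not_regular_if_many_residues:
  fixes M :: int
  assumes "M > 0"
    and sep: "\<And>m :: nat. \<exists>l r. (\<forall>i<m. r i < k ^ l) \<and>
      (\<forall>i j. i < j \<longrightarrow> j < m \<longrightarrow>
        (\<exists>n\<ge>1. \<not> [s (k ^ l * n + r i) = s (k ^ l * n + r j)] (mod M)))"
  shows "\<not> regular_seq k s"
proof
  assume "regular_seq k s"
  let ?F = "(\<lambda>f. \<lambda>n\<in>{1..}. f n mod M) ` Defs.kernel k s"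
  have fin: "finite ?F"
    by (rule finite_kernel_mod_of_regular) fact+
  define m where "m = Suc (card ?F)"
  obtain l r where r: "\<And>i. i < m \<Longrightarrow> r i < k ^ l"
    and ne: "\<And>i j. i < j \<Longrightarrow> j < m \<Longrightarrow>
      \<exists>n\<ge>1. \<not> [s (k ^ l * n + r i) = s (k ^ l * n + r j)] (mod M)"
    using sep[of m] by blast
  define h where "h i = (\<lambda>n\<in>{1..}. s (k ^ l * n + r i) mod M)" for i
  have "h i \<in> ?F" if "i < m" for i
  proof (rule image_eqI)
    show "h i = (\<lambda>n\<in>{1..}. (\<lambda>n\<in>{1..}. s (k ^ l * n + r i)) n mod M)"
      by (auto simp: h_def fun_eq_iff restrict_def)
    show "(\<lambda>n\<in>{1..}. s (k ^ l * n + r i)) \<in> Defs.kernel k s"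
      using r[OF that] by (auto simp: Defs.kernel_def)
  qed
  then have sub: "h ` {..<m} \<subseteq> ?F" by blast
  have "h i \<noteq> h j" if ij: "i < j" "j < m" for i j
  proof
    assume eq: "h i = h j"
    obtain n where n: "n \<ge> 1" "\<not> [s (k ^ l * n + r i) = s (k ^ l * n + r j)] (mod M)"
      using ne[OF ij] by blast
    show False
      using fun_cong[OF eq, of n] n by (simp add: h_def cong_def)
  qed
  then have "inj_on h {..<m}"
    by (intro linorder_inj_onI) auto
  then have "m \<le> card ?F"
    using card_inj_on_le[OF _ sub fin] by simp
  then show False by (simp add: m_def)
qed

section \<open>Values of \<open>rho\<close> and \<open>tau\<close>\<close>

lemma rho_prime_power:
  assumes "prime q" "e > 0"
  shows "rho (q ^ e) = 2"
proof -
  have "{p. prime p \<and> p dvd q ^ e} = {q}"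
    using assms by (auto dest: prime_dvd_power primes_dvd_imp_eq)
  then show ?thesis by (simp add: rho_def omega_def)
qed

lemma four_dvd_rho:
  assumes "prime q" "q dvd N" "prime p" "p dvd N" "p \<noteq> q" "N > 0"
  shows "4 dvd rho N"
proof -
  have "card {p, q} \<le> omega N"
    unfolding omega_def using assms
    by (intro card_mono) (auto intro: finite_subset[of _ "{..N}"] dest: dvd_imp_le)
  then have "(2::nat) ^ 2 dvd 2 ^ omega N"
    using assms by (intro le_imp_power_dvd) simp
  then show ?thesis by (simp add: rho_def)
qed

text \<open>Each divisor of \<open>q ^ a * m\<close> is \<open>q ^ i * d\<close> for exactly one
  pair with \<open>i \<le> a\<close> and \<open>d dvd m\<close>: its multiplicity at
  \<open>q\<close> recovers \<open>i\<close>, and then cancellation recovers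
  \<open>d\<close>.\<close>

lemma tau_prime_power_mult:
  assumes q: "prime q" and m: "\<not> q dvd m" "m > 0"
  shows "tau (q ^ a * m) = Suc a * tau m"
proof -
  let ?f = "\<lambda>(i, d). q ^ i * d"
  have "bij_betw ?f ({..a} \<times> {d. d dvd m}) {d. d dvd q ^ a * m}"
    unfolding bij_betw_def
  proof
    have mult: "multiplicity q (q ^ i * d) = i" if "d dvd m" for i d
      using that q m by (intro multiplicity_eqI) (auto dest: dvd_trans)
    show "inj_on ?f ({..a} \<times> {d. d dvd m})"
    proof (rule inj_onI; clarify)
      fix i d j e
      assume d: "d dvd m" "e dvd m" and eq: "q ^ i * d = q ^ j * e"
      then have "i = j" using mult by metis
      then show "i = j \<and> d = e" using eq q by auto
    qed
    show "?f ` ({..a} \<times> {d. d dvd m}) = {d. d dvd q ^ a * m}"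
    proof
      show "?f ` ({..a} \<times> {d. d dvd m}) \<subseteq> {d. d dvd q ^ a * m}"
        by (auto intro!: mult_dvd_mono le_imp_power_dvd)
      show "{d. d dvd q ^ a * m} \<subseteq> ?f ` ({..a} \<times> {d. d dvd m})"
      proof
        fix x assume "x \<in> {d. d dvd q ^ a * m}"
        then obtain b c where x: "x = b * c" "b dvd q ^ a" "c dvd m"
          using division_decomp[of x "q ^ a" m] by auto
        then obtain i where "i \<le> a" "b = q ^ i"
          using divides_primepow_nat[OF q] by auto
        with x show "x \<in> ?f ` ({..a} \<times> {d. d dvd m})" by force
      qed
    qed
  qed
  then have "card ({..a} \<times> {d. d dvd m}) = card {d. d dvd q ^ a * m}"
    by (rule bij_betw_same_card)
  then show ?thesis by (simp add: tau_def card_cartesian_product)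
qed

text \<open>All prime exponents of \<open>z ^ c\<close> are multiples of \<open>c\<close>, so each
  contributes a factor \<open>a * c + 1\<close> to \<open>tau\<close>. The induction splits off the
  full power of one prime at a time.\<close>

lemma tau_power_cong_1:
  assumes "z > 0"
  shows "[tau (z ^ c) = 1] (mod c)"
  using assms
proof (induction z rule: less_induct)
  case (less z)
  show ?case
  proof (cases "z = 1")
    case True
    then show ?thesis by (simp add: tau_def)
  next
    case False
    then obtain p where p: "prime p" "p dvd z" using prime_factor_nat by blast
    obtain m where m: "z = p ^ multiplicity p z * m" "\<not> p dvd m"
      using multiplicity_decompose'[of z p] less.prems not_prime_unit[of p] p(1) by blast
    define a where "a = multiplicity p z"
    have a: "z = p ^ a * m" using m(1) by (simp add: a_def)
    have m0: "m > 0" using less.prems m(1) by (cases m) auto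
    have "a > 0" using p m(2) a by (cases a) auto
    then have "p ^ a > 1" using p(1) prime_gt_1_nat by (intro one_less_power) auto
    then have "m < z" using a m0 by simp
    have "z ^ c = p ^ (a * c) * m ^ c"
      by (simp add: a power_mult_distrib power_mult)
    moreover have "\<not> p dvd m ^ c"
      using p(1) m(2) prime_dvd_power by blast
    ultimately have "tau (z ^ c) = Suc (a * c) * tau (m ^ c)"
      using tau_prime_power_mult[OF p(1)] m0 by simp
    moreover have "[Suc (a * c) * tau (m ^ c) = 1 * 1] (mod c)"
      using less.IH[OF \<open>m < z\<close> m0] by (intro cong_mult) (auto simp: cong_def mod_Suc)
    ultimately show ?thesis by simp
  qed
qed

section \<open>Prime powers in residue classes: the sequence \<open>rho\<close>\<close>

lemma less_power_self:
  fixes k n :: nat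
  assumes "k \<ge> 2"
  shows "n < k ^ n"
  using less_exp[of n] power_mono[OF assms, of n] by (meson le0 order_less_le_trans)

lemma rho_not_regular:
  assumes "k \<ge> 2"
  shows "\<not> regular_seq k (\<lambda>n. int (rho n))"
proof (rule not_regular_if_many_residues[where M = 4])
  fix m
  obtain q where q: "prime q" "q > k" using bigger_prime by blast
  have q1: "q > 1" using q(1) prime_gt_1_nat by blast
  \<comment> \<open>Any level with \<open>q ^ m < k ^ l\<close> would do; this one is large enough
    because \<open>l < k ^ l\<close>.\<close>
  define l where "l = q ^ m"
  define r where "r i = q ^ Suc i" for i :: nat
  define K where "K = k ^ l"
  have "coprime q k"
    using q assms by (intro prime_imp_coprime) (auto dest: dvd_imp_le)
  then have "coprime q K" by (simp add: K_def)
  have K: "q ^ m < K" unfolding K_def l_def using less_power_self[OF assms] .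
  show "\<exists>l r. (\<forall>i<m. r i < k ^ l) \<and>
      (\<forall>i j. i < j \<longrightarrow> j < m \<longrightarrow>
        (\<exists>n\<ge>1. \<not> [int (rho (k ^ l * n + r i)) = int (rho (k ^ l * n + r j))] (mod 4)))"
  proof (rule exI[of _ l], rule exI[of _ r], intro conjI allI impI)
    fix i assume "i < m"
    then have "r i \<le> q ^ m" unfolding r_def using q1 by (intro power_increasing) auto
    then show "r i < k ^ l" using K by (simp add: K_def)
  next
    fix i j assume ij: "i < j" "j < m"
    define t where "t = totient K"
    have t: "t > 0" using K by (simp add: t_def)
    have "[q ^ t = 1] (mod K)"
      unfolding t_def using \<open>coprime q K\<close> by (rule euler_theorem)
    moreover have qt: "q ^ t > 1" using q1 t by (intro one_less_power)
    ultimately have "K dvd q ^ t - 1" by (subst (asm) cong_altdef_nat) auto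
    then obtain u where "q ^ t - 1 = K * u" by blast
    then have u: "q ^ t = 1 + K * u" using qt by simp
    have u0: "u > 0" using u qt by (cases u) auto
    \<comment> \<open>With this choice \<open>K * n + r j = r j * (1 + K * u) = r j * q ^ t\<close>,
      a pure power of \<open>q\<close>.\<close>
    define n where "n = r j * u"
    have n: "n \<ge> 1" using u0 q1 by (simp add: n_def r_def)
    have j: "K * n + r j = q ^ (Suc j + t)"
      unfolding n_def by (simp add: power_add u r_def algebra_simps)
    obtain d where d: "j = i + Suc d" using ij(1) less_imp_Suc_add by auto
    \<comment> \<open>As \<open>i < j\<close>, the term \<open>K * n\<close> has at least one more
      factor \<open>q\<close> than \<open>r i\<close>, so the cofactor \<open>C\<close> is 1 modulo
      \<open>q\<close>.\<close>
    define C where "C = 1 + K * (q ^ Suc d * u)"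
    have i: "K * n + r i = q ^ Suc i * C"
      by (simp add: n_def r_def C_def d power_add algebra_simps)
    have C0: "C > 0" by (simp add: C_def)
    have "C \<noteq> 1" using u0 q1 K by (simp add: C_def)
    then obtain p where p: "prime p" "p dvd C" using prime_factor_nat by blast
    have "\<not> q dvd C"
    proof
      assume "q dvd C"
      moreover have "q dvd K * (q ^ Suc d * u)" by simp
      ultimately have "q dvd 1" unfolding C_def using dvd_add_left_iff by blast
      then show False using q1 by simp
    qed
    then have "p \<noteq> q" using p by auto
    then have "4 dvd rho (K * n + r i)"
      using p q(1) q1 i C0 by (intro four_dvd_rho[of q _ p]) auto
    then have "int (rho (K * n + r i)) mod 4 = 0" by presburger
    moreover have "rho (K * n + r j) = 2"
      unfolding j using q(1) by (intro rho_prime_power) auto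
    ultimately have "\<not> [int (rho (K * n + r i)) = int (rho (K * n + r j))] (mod 4)"
      by (simp add: cong_def)
    then show "\<exists>n\<ge>1. \<not> [int (rho (k ^ l * n + r i)) = int (rho (k ^ l * n + r j))] (mod 4)"
      using n unfolding K_def by blast
  qed
qed simp

section \<open>Sixth powers in residue classes\<close>

lemma power_one_plus_cong:
  fixes x :: int
  shows "[(1 + x) ^ n = 1 + int n * x] (mod x\<^sup>2)"
proof (induction n)
  case (Suc n)
  have "[(1 + x) ^ Suc n = (1 + x) * (1 + int n * x)] (mod x\<^sup>2)"
    using cong_mult[OF cong_refl Suc.IH] by simp
  also have "(1 + x) * (1 + int n * x) = 1 + int (Suc n) * x + int n * x\<^sup>2"
    by (simp add: algebra_simps power2_eq_square)
  also have "[\<dots> = 1 + int (Suc n) * x] (mod x\<^sup>2)"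
    by (simp add: cong_iff_dvd_diff)
  finally show ?case .
qed simp

text \<open>If \<open>q\<close> divides \<open>z\<close> and \<open>K * n + r j = z ^ 6\<close>,
  then \<open>K * n + r i = z ^ 6 - r j + r i\<close> is congruent to \<open>6 * (i - j) * q\<close>
  modulo the square of \<open>q\<close>, so \<open>q\<close> divides it exactly once.\<close>

lemma sixth_power_vs_simple_prime:
  fixes k m :: nat
  assumes "k \<ge> 2"
  shows "\<exists>l r. (\<forall>i<m. r i < k ^ l) \<and>
    (\<forall>i j. i < j \<longrightarrow> j < m \<longrightarrow>
      (\<exists>n\<ge>1. (\<exists>z>0. k ^ l * n + r j = z ^ 6) \<and>
        (\<exists>q B. prime q \<and> B > 0 \<and> \<not> q dvd B \<and> k ^ l * n + r i = q * B)))"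
proof -
  \<comment> \<open>The bound keeps \<open>q\<close> coprime to \<open>k\<close> and from dividing 6
    or any difference \<open>j - i\<close>.\<close>
  obtain q where q: "prime q" "q > k + m + 3" using bigger_prime by blast
  define y where "y i = 1 + i * q" for i :: nat
  define r where "r i = y i ^ 6" for i
  define l where "l = r m"
  define K where "K = k ^ l"
  have "coprime q k"
    using q assms by (intro prime_imp_coprime) (auto dest: dvd_imp_le)
  then have cop: "coprime K q" by (simp add: K_def coprime_commute)
  have K: "r m < K" unfolding K_def l_def using less_power_self[OF assms] .
  show ?thesis
  proof (rule exI[of _ l], rule exI[of _ r], intro conjI allI impI)
    fix i assume "i < m"
    then have "r i \<le> r m" unfolding r_def y_def by (intro power_mono) auto
    then show "r i < k ^ l" using K by (simp add: K_def)
  next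
    fix i j assume ij: "i < j" "j < m"
    obtain x where x: "[K * x = 1] (mod q)"
      using cong_solve_coprime_nat[OF cop] by auto
    \<comment> \<open>An explicit Chinese remainder solution: \<open>z\<close> is \<open>y j\<close>
      modulo \<open>K\<close>, and \<open>q * y j\<close>, hence 0, modulo \<open>q\<close>.\<close>
    define t where "t = x * ((q - 1) * y j)"
    define z where "z = y j + K * t"
    have "[y j + (K * x) * ((q - 1) * y j) = y j + 1 * ((q - 1) * y j)] (mod q)"
      using x by (intro cong_add cong_mult) auto
    also have "y j + 1 * ((q - 1) * y j) = q * y j"
      using q by (cases q) auto
    finally have qz: "q dvd z"
      by (simp add: z_def t_def cong_def mult.assoc mod_eq_0_iff_dvd)
    \<comment> \<open>Since \<open>y j\<close> is 1 modulo \<open>q\<close> while \<open>q\<close>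
      divides \<open>z\<close>, the two differ; this makes \<open>z > y j\<close> and finally
      \<open>n \<ge> 1\<close>.\<close>
    have "\<not> q dvd y j"
      using q dvd_add_left_iff[of q "j * q" 1] by (auto simp: y_def)
    then have t0: "t > 0" using qz by (cases t) (auto simp: z_def)
    have zy: "z > y j" using t0 K by (simp add: z_def)
    have "[z ^ 6 = y j ^ 6] (mod K)"
      unfolding z_def by (intro cong_pow) (simp add: cong_def)
    moreover have zr: "z ^ 6 > y j ^ 6" using zy by (intro power_strict_mono) auto
    ultimately have "K dvd z ^ 6 - y j ^ 6" using zy by (subst (asm) cong_altdef_nat) auto
    then obtain n where "z ^ 6 - y j ^ 6 = K * n" by blast
    then have n: "z ^ 6 = r j + K * n" using zr by (simp add: r_def)
    have n1: "n \<ge> 1" using n zr by (cases n) (auto simp: r_def)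
    have zeq: "K * n + r j = z ^ 6" using n by simp
    have r_cong: "[int (r a) = 1 + 6 * (int a * int q)] (mod (int q)\<^sup>2)" for a
    proof -
      have "[(1 + int a * int q) ^ 6 = 1 + 6 * (int a * int q)] (mod (int q)\<^sup>2)"
        using cong_dvd_modulus[OF power_one_plus_cong[of "int a * int q" 6], of "(int q)\<^sup>2"]
        by (simp add: power_mult_distrib)
      then show ?thesis by (simp add: r_def y_def)
    qed
    have "q ^ 2 dvd z ^ 6"
      using qz by (intro dvd_power_le) auto
    then have "(int q)\<^sup>2 dvd int (z ^ 6)"
      by (metis of_nat_dvd_iff of_nat_power)
    then have z_cong: "[int (z ^ 6) = 0] (mod (int q)\<^sup>2)"
      by (simp add: cong_0_iff)
    define A where "A = K * n + r i"
    have "int (z ^ 6) - int (r j) + int (r i) = int A"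
      by (simp add: A_def n del: of_nat_power)
    moreover have "[int (z ^ 6) - int (r j) + int (r i) =
        0 - (1 + 6 * (int j * int q)) + (1 + 6 * (int i * int q))] (mod (int q)\<^sup>2)"
      by (intro cong_add cong_diff z_cong r_cong)
    ultimately have
      "[int A = - (1 + 6 * (int j * int q)) + (1 + 6 * (int i * int q))] (mod (int q)\<^sup>2)"
      by (simp only: diff_0)
    then have "(int q)\<^sup>2 dvd int A + 6 * (int j - int i) * int q"
      by (simp add: cong_iff_dvd_diff algebra_simps)
    then obtain w where w: "int A + 6 * (int j - int i) * int q = (int q)\<^sup>2 * w" by auto
    have AB: "int A = int q * (int q * w - 6 * (int j - int i))"
      using w by (simp add: algebra_simps power2_eq_square)
    then have "q dvd A" by (metis dvd_triv_left of_nat_dvd_iff)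
    then obtain B where B: "A = q * B" by auto
    have iB: "int B = int q * w - 6 * (int j - int i)"
      using AB q by (simp add: B)
    have nB: "\<not> q dvd B"
    proof
      assume "q dvd B"
      then have "int q dvd int q * w - int B" by (intro dvd_diff) auto
      also have "int q * w - int B = int (6 * (j - i))" using iB ij by simp
      finally have "q dvd 6 * (j - i)" by (simp only: of_nat_dvd_iff)
      moreover have "\<not> q dvd 6"
      proof
        assume "q dvd 6"
        then have "q dvd 2 * 3" by simp
        then have "q dvd 2 \<or> q dvd 3" using q(1) prime_dvd_mult_iff by blast
        then show False using q(2) by (auto dest: dvd_imp_le)
      qed
      ultimately have "q dvd j - i" using q(1) prime_dvd_mult_iff by blast
      then show False using ij q(2) by (auto dest: dvd_imp_le)
    qed
    then have "B > 0" by (cases B) auto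
    then have "\<exists>q B. prime q \<and> B > 0 \<and> \<not> q dvd B \<and> k ^ l * n + r i = q * B"
      using q(1) nB B unfolding A_def K_def by (intro exI[of _ q] exI[of _ B] conjI)
    moreover have "\<exists>z>0. k ^ l * n + r j = z ^ 6"
      using order_le_less_trans[OF le0 zy] zeq unfolding K_def by (intro exI[of _ z] conjI)
    ultimately show "\<exists>n\<ge>1. (\<exists>z>0. k ^ l * n + r j = z ^ 6) \<and>
        (\<exists>q B. prime q \<and> B > 0 \<and> \<not> q dvd B \<and> k ^ l * n + r i = q * B)"
      using n1 by - (rule exI[of _ n], intro conjI)
  qed
qed

section \<open>The two divisor-function sequences\<close>

lemma not_regular_if_separates_sixth_powers:
  fixes M :: int
  assumes "k \<ge> 2" "M > 0"
    and "\<And>z q B. \<lbrakk>z > 0; prime q; B > 0; \<not> q dvd B\<rbrakk> \<Longrightarrow> \<not> [s (q * B) = s (z ^ 6)] (mod M)"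
  shows "\<not> regular_seq k s"
proof (rule not_regular_if_many_residues[OF assms(2)])
  fix m :: nat
  show "\<exists>l r. (\<forall>i<m. r i < k ^ l) \<and>
      (\<forall>i j. i < j \<longrightarrow> j < m \<longrightarrow>
        (\<exists>n\<ge>1. \<not> [s (k ^ l * n + r i) = s (k ^ l * n + r j)] (mod M)))"
    using sixth_power_vs_simple_prime[OF assms(1), of m] assms(3) by metis
qed

lemma tau_square_arg_not_regular:
  assumes "k \<ge> 2"
  shows "\<not> regular_seq k (\<lambda>n. int (tau (n ^ 2)))"
proof (rule not_regular_if_separates_sixth_powers[OF assms, where M = 3])
  fix z q B :: nat
  assume z: "z > 0" and q: "prime q" "B > 0" "\<not> q dvd B"
  \<comment> \<open>In the square of \<open>q * B\<close> the prime \<open>q\<close> has exponent 2,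
    which gives the factor 3 of \<open>tau\<close>.\<close>
  have "\<not> q dvd B\<^sup>2" using q prime_dvd_power by blast
  then have "tau ((q * B)\<^sup>2) = 3 * tau (B\<^sup>2)"
    using tau_prime_power_mult[OF q(1), of "B\<^sup>2" 2] q(2) by (simp add: power_mult_distrib)
  moreover have "[tau ((z ^ 6)\<^sup>2) = 1] (mod 3)"
    using cong_dvd_modulus_nat[OF tau_power_cong_1[OF z, of 12], of 3] by (simp flip: power_mult)
  ultimately have "\<not> [tau ((q * B)\<^sup>2) = tau ((z ^ 6)\<^sup>2)] (mod 3)"
    by (simp add: cong_def)
  then show "\<not> [int (tau ((q * B)\<^sup>2)) = int (tau ((z ^ 6)\<^sup>2))] (mod 3)"
    using cong_int_iff[of _ _ 3] by simp
qed simp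

lemma tau_squared_not_regular:
  assumes "k \<ge> 2"
  shows "\<not> regular_seq k (\<lambda>n. int ((tau n) ^ 2))"
proof (rule not_regular_if_separates_sixth_powers[OF assms, where M = 2])
  fix z q B :: nat
  assume z: "z > 0" and q: "prime q" "B > 0" "\<not> q dvd B"
  \<comment> \<open>The exponent 1 of \<open>q\<close> gives \<open>tau\<close> a factor 2; on sixth
    powers all exponents are even, so \<open>tau\<close> is odd.\<close>
  have "even (tau (q * B))"
    using tau_prime_power_mult[OF q(1,3,2), of 1] by simp
  moreover have "[tau (z ^ 6) = 1] (mod 2)"
    using cong_dvd_modulus_nat[OF tau_power_cong_1[OF z, of 6], of 2] by simp
  then have "odd (tau (z ^ 6))" unfolding cong_def by presburger
  ultimately show "\<not> [int ((tau (q * B))\<^sup>2) = int ((tau (z ^ 6))\<^sup>2)] (mod 2)"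
    by (simp add: cong_iff_dvd_diff)
qed simp

theorem theorem3p4:
  fixes k :: nat
  assumes "k \<ge> 2"
  shows "\<not> regular_seq k (\<lambda>n. int (rho n))
       \<and> \<not> regular_seq k (\<lambda>n. int (tau (n ^ 2)))
       \<and> \<not> regular_seq k (\<lambda>n. int ((tau n) ^ 2))"
  by (intro conjI rho_not_regular tau_square_arg_not_regular tau_squared_not_regular assms)

end
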